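(* Let $\alpha\in(0,1/2]$ and let $\mathcal{T}$ be an $\alpha$-tree on a measure space $(X,\mu)$. Let $\varphi$ be a $\mathcal{T}$-simple real function on $X$, and set $\varepsilon=\|\varphi\|_{\mathrm{BMO}(\mathcal{T})}$ (note that $\varphi$ is bounded and thus in $\mathrm{BMO}(\mathcal{T})$). (i) If $B$ is an $\alpha$-concave function on $\Omega_\varepsilon$, then $$ B\big(\langle\varphi\rangle_{X,\mu},\langle\varphi^2\rangle_{X,\mu}\big)\ge \frac1{\mu(X)}\int_X B(\varphi,\varphi^2)\,d\mu. $$ (ii) If $b$ is an $\alpha$-convex function on $\Omega_\varepsilon$, then $$ b\big(\langle\varphi\rangle_{X,\mu},\langle\varphi^2\rangle_{X,\mu}\big)\le \frac1{\mu(X)}\int_X b(\varphi,\varphi^2)\,d\mu. $$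
   Context: Notation: $\langle\varphi\rangle_{J,\mu}=\frac1{\mu(J)}\int_J\varphi\,d\mu$. For $\varepsilon\ge0$, $\Omega_\varepsilon=\{x=(x_1,x_2)\in\mathbb{R}^2:\ x_1^2\le x_2\le x_1^2+\varepsilon^2\}$. $\alpha$-tree: let $(X,\mu)$ be a measure space with $0<\mu(X)<\infty$ and $\alpha\in(0,1/2]$. A collection $\mathcal{T}$ of measurable subsets of $X$ is an $\alpha$-tree if: (1) $X\in\mathcal{T}$; (2) for every $J\in\mathcal{T}$ there is a subset $C(J)\subset\mathcal{T}$ (the children of $J$) such that $J=\bigcup_{I\in C(J)}I$, the elements of $C(J)$ are pairwise disjoint up to sets of measure zero, and $\mu(I)\ge\alpha\mu(J)$ for every $I\in C(J)$; (3) $\mathcal{T}=\bigcup_{m\ge0}\mathcal{T}_m$, where $\mathcal{T}_0=\{X\}$ and $\mathcal{T}_{m+1}=\bigcup_{J\in\mathcal{T}_m}C(J)$; (4) $\mathcal{T}$ differentiates $L^1(X,\mu)$, i.e. for every $f\in L^1(X,\mu)$, for $\mu$-a.e. $x$, the averages $\langle f\rangle_{J_m,\mu}$ over the elements $J_m\in\mathcal{T}_m$ containing $x$ converge to $f(x)$ as $m\to\infty$. A function $\varphi$ on $X$ is $\mathcal{T}$-simple if there is $N\ge0$ such that $\varphi$ is constant $\mu$-a.e. on each element of $\mathcal{T}_N$. $\|\varphi\|_{\mathrm{BMO}(\mathcal{T})}=\sup_{J\in\mathcal{T}}\big(\langle\varphi^2\rangle_{J,\mu}-\langle\varphi\rangle_{J,\mu}^2\big)^{1/2}$,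 and $\mathrm{BMO}(\mathcal{T})$ is the set of functions for which this is finite. A real function $B$ on $\Omega_\varepsilon$ is $\alpha$-concave if $B(\beta x^-+(1-\beta)x^+)\ge\beta B(x^-)+(1-\beta)B(x^+)$ for every $\beta\in[\alpha,\frac12]$ and any two points $x^\pm\in\Omega_\varepsilon$ such that $\beta x^-+(1-\beta)x^+\in\Omega_\varepsilon$. A function $b$ on $\Omega_\varepsilon$ is $\alpha$-convex if the reverse inequality $b(\beta x^-+(1-\beta)x^+)\le\beta b(x^-)+(1-\beta)b(x^+)$ holds for all such $\beta,x^-,x^+$. *)

theory Defs
  imports "HOL-Analysis.Analysis"
begin

text \<open>
  Neither a function that is constant almost everywhere on some set, nor the composition of such a
  function with an arbitrary \<open>B\<close>, need be measurable when \<open>M\<close> is not complete, and the Bochner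
  integral of a non-measurable function is \<open>0\<close>. Integrals are therefore taken with respect to the
  completion of \<open>M\<close>; on \<open>M\<close>-measurable functions this is the integral with respect to \<open>M\<close>.
\<close>

definition avg :: "'a measure \<Rightarrow> 'a set \<Rightarrow> ('a \<Rightarrow> real) \<Rightarrow> real" where
  "avg M J f = 1 / measure M J * (LINT x:J|completion M. f x)"

definition Omega :: "real \<Rightarrow> (real \<times> real) set" where
  "Omega \<epsilon> = {(x1, x2). x1\<^sup>2 \<le> x2 \<and> x2 \<le> x1\<^sup>2 + \<epsilon>\<^sup>2}"

primrec generation :: "'a measure \<Rightarrow> ('a set \<Rightarrow> 'a set set) \<Rightarrow> nat \<Rightarrow> 'a set set" where
  "generation M C 0 = {space M}"
| "generation M C (Suc m) = (\<Union>J\<in>generation M C m. C J)"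

text \<open>
  The children map \<open>C\<close> is part of the data, since the generations are not determined by the
  collection \<open>T\<close> alone. Almost every point lies in exactly one element of each generation; the last
  clause quantifies over all choices of elements, so nothing has to be selected on the exceptional
  null set.
\<close>

definition alpha_tree ::
  "real \<Rightarrow> 'a measure \<Rightarrow> 'a set set \<Rightarrow> ('a set \<Rightarrow> 'a set set) \<Rightarrow> bool" where
  "alpha_tree \<alpha> M T C \<longleftrightarrow>
     0 < emeasure M (space M) \<and> emeasure M (space M) < \<infinity> \<and>
     0 < \<alpha> \<and> \<alpha> \<le> 1/2 \<and>
     T \<subseteq> sets M \<and>
     space M \<in> T \<and>
     (\<forall>J\<in>T. C J \<subseteq> T \<and> J = \<Union>(C J) \<and>
        pairwise (\<lambda>I I'. I \<inter> I' \<in> null_sets M) (C J) \<and>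
        (\<forall>I\<in>C J. measure M I \<ge> \<alpha> * measure M J)) \<and>
     T = (\<Union>m. generation M C m) \<and>
     (\<forall>f::'a \<Rightarrow> real. integrable M f \<longrightarrow>
        (AE x in M. \<forall>J. (\<forall>m. J m \<in> generation M C m \<and> x \<in> J m) \<longrightarrow>
           (\<lambda>m. avg M (J m) f) \<longlonglongrightarrow> f x))"

definition tree_simple ::
  "'a measure \<Rightarrow> ('a set \<Rightarrow> 'a set set) \<Rightarrow> ('a \<Rightarrow> real) \<Rightarrow> bool" where
  "tree_simple M C \<phi> \<longleftrightarrow>
     (\<exists>N. \<forall>J\<in>generation M C N. \<exists>c. AE x in M. x \<in> J \<longrightarrow> \<phi> x = c)"

definition bmo_norm :: "'a measure \<Rightarrow> 'a set set \<Rightarrow> ('a \<Rightarrow> real) \<Rightarrow> ereal" where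
  "bmo_norm M T \<phi> =
     (SUP J\<in>T. ereal (sqrt (avg M J (\<lambda>x. (\<phi> x)\<^sup>2) - (avg M J \<phi>)\<^sup>2)))"

text \<open>
  Integrability is required explicitly because \<open>bmo_norm\<close> is meaningful only when the averages of
  \<open>\<phi>\<close> and \<open>\<phi>\<^sup>2\<close> exist.
\<close>

definition BMO :: "'a measure \<Rightarrow> 'a set set \<Rightarrow> ('a \<Rightarrow> real) set" where
  "BMO M T = {\<phi>. integrable (completion M) \<phi> \<and>
                 integrable (completion M) (\<lambda>x. (\<phi> x)\<^sup>2) \<and>
                 bmo_norm M T \<phi> < \<infinity>}"

definition alpha_concave_on ::
  "real \<Rightarrow> (real \<times> real) set \<Rightarrow> (real \<times> real \<Rightarrow> real) \<Rightarrow> bool" where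
  "alpha_concave_on \<alpha> S B \<longleftrightarrow>
     (\<forall>\<beta>\<in>{\<alpha>..1/2}. \<forall>x\<in>S. \<forall>y\<in>S. \<beta> *\<^sub>R x + (1 - \<beta>) *\<^sub>R y \<in> S \<longrightarrow>
        B (\<beta> *\<^sub>R x + (1 - \<beta>) *\<^sub>R y) \<ge> \<beta> * B x + (1 - \<beta>) * B y)"

definition alpha_convex_on ::
  "real \<Rightarrow> (real \<times> real) set \<Rightarrow> (real \<times> real \<Rightarrow> real) \<Rightarrow> bool" where
  "alpha_convex_on \<alpha> S b \<longleftrightarrow>
     (\<forall>\<beta>\<in>{\<alpha>..1/2}. \<forall>x\<in>S. \<forall>y\<in>S. \<beta> *\<^sub>R x + (1 - \<beta>) *\<^sub>R y \<in> S \<longrightarrow>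
        b (\<beta> *\<^sub>R x + (1 - \<beta>) *\<^sub>R y) \<le> \<beta> * b x + (1 - \<beta>) * b y)"

end

theory Submission
  imports Defs
begin

text \<open>
  Write \<open>x\<^sub>J = (\<langle>\<phi>\<rangle>\<^sub>J, \<langle>\<phi>\<^sup>2\<rangle>\<^sub>J)\<close>. The point \<open>x\<^sub>J\<close> is the average of the points of the children of \<open>J\<close>, and
  all these points lie in \<open>\<Omega>\<^sub>\<epsilon>\<close>. The non-convex domain is handled by splitting off one child at a
  time. If \<open>x = \<Sum>\<^sub>i w\<^sub>i x\<^sub>i\<close>, let \<open>l\<close> be the affine function whose zero set is the tangent to the upper
  boundary parabola above \<open>x\<close>. Then \<open>l(x) \<le> 0\<close>, and \<open>l(x\<^sub>j) \<ge> l(x)\<close> for some \<open>j\<close>, so the average \<open>y\<close> of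
  the remaining points has \<open>l(y) \<le> l(x) \<le> 0\<close> and thus stays below the upper parabola, by its
  convexity. Removing a point and renormalizing only increases the other weights, so all splitting
  ratios stay admissible, and induction on the number of children followed by downward induction on
  the generations, starting where \<open>\<phi>\<close> is constant, proves the inequality.
\<close>

section \<open>Finite convex combinations in the parabolic strip\<close>

text \<open>Only the upper constraint restricts the choice of \<open>j\<close>. The lower one
  survives for every \<open>j\<close>, since the region above a parabola is convex.\<close>

lemma split_off_point_in_Omega:
  fixes w :: "'i \<Rightarrow> real" and x :: "'i \<Rightarrow> real \<times> real"
  assumes fin: "finite I"
    and sum1: "sum w I = 1"
    and pos: "\<And>i. i \<in> I \<Longrightarrow> 0 < w i" and less1: "\<And>i. i \<in> I \<Longrightarrow> w i < 1"
    and mem: "\<And>i. i \<in> I \<Longrightarrow> x i \<in> Omega \<epsilon>"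
    and bary: "(\<Sum>i\<in>I. w i *\<^sub>R x i) \<in> Omega \<epsilon>"
  obtains j where "j \<in> I" "(\<Sum>i\<in>I - {j}. (w i / (1 - w j)) *\<^sub>R x i) \<in> Omega \<epsilon>"
proof -
  define p where "p = (\<Sum>i\<in>I. w i *\<^sub>R x i)"
  define a where "a = fst p"
  \<comment> \<open>The tangent to the upper parabola at abscissa \<open>a\<close> is the level set
    \<open>d z = \<epsilon>\<^sup>2 - a\<^sup>2\<close>. Dropping the constant makes
    \<open>d\<close> linear, so it commutes with sums whatever the total weight.\<close>
  define d where "d z = snd z - 2 * a * fst z" for z :: "real \<times> real"
  have d_lin: "d (\<Sum>i\<in>S. v i *\<^sub>R x i) = (\<Sum>i\<in>S. v i * d (x i))" for S and v :: "'i \<Rightarrow> real"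
    by (simp add: d_def fst_sum snd_sum sum_distrib_left right_diff_distrib sum_subtractf mult_ac)
  have d_p: "d p \<le> \<epsilon>\<^sup>2 - a\<^sup>2"
    using bary by (auto simp: Omega_def p_def[symmetric] d_def a_def power2_eq_square split: prod.splits)
  \<comment> \<open>The weighted mean \<open>d p\<close> cannot strictly exceed every
    \<open>d (x j)\<close>.\<close>
  have "\<exists>j\<in>I. d p \<le> d (x j)"
  proof (rule ccontr)
    assume "\<not> ?thesis"
    moreover have "I \<noteq> {}"
      using sum1 by auto
    ultimately have "(\<Sum>i\<in>I. w i * d (x i)) < (\<Sum>i\<in>I. w i * d p)"
      using fin pos by (intro sum_strict_mono) auto
    then show False
      using sum1 by (simp add: d_lin p_def flip: sum_distrib_right)
  qed
  then obtain j where j: "j \<in> I" "d p \<le> d (x j)"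
    by blast
  define v where "v i = w i / (1 - w j)" for i
  define y where "y = (\<Sum>i\<in>I - {j}. v i *\<^sub>R x i)"
  have wj: "0 < w j" "w j < 1"
    using pos less1 j by auto
  have v_nonneg: "0 \<le> v i" if "i \<in> I - {j}" for i
    using wj pos[of i] that by (simp add: v_def)
  have v_sum: "sum v (I - {j}) = 1"
    using wj fin j sum1 by (simp add: v_def sum_diff1 flip: sum_divide_distrib)
  have "p = w j *\<^sub>R x j + (1 - w j) *\<^sub>R y"
    using fin j wj by (simp add: p_def y_def v_def sum.remove[of I j] scaleR_sum_right)
  then have "d p = w j * d (x j) + (1 - w j) * d y"
    by (simp only: d_def fst_add snd_add fst_scaleR snd_scaleR real_scaleR_def)
      (simp add: algebra_simps)
  moreover have "w j * d p \<le> w j * d (x j)"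
    using j wj by simp
  ultimately have "(1 - w j) * d y \<le> (1 - w j) * d p"
    by (simp add: algebra_simps)
  then have "d y \<le> d p"
    using wj by simp
  then have "snd y \<le> \<epsilon>\<^sup>2 - a\<^sup>2 + 2 * a * fst y"
    using d_p by (simp add: d_def)
  \<comment> \<open>The tangent line at \<open>a\<close> lies below the upper parabola at abscissa
    \<open>fst y\<close>.\<close>
  also have "\<dots> \<le> \<epsilon>\<^sup>2 + (fst y)\<^sup>2"
    using zero_le_power2[of "fst y - a"] by (simp add: power2_diff algebra_simps)
  finally have upper: "snd y \<le> (fst y)\<^sup>2 + \<epsilon>\<^sup>2"
    by simp
  \<comment> \<open>For the lower constraint, each \<open>x i\<close> lies above the tangent to the
    lower parabola at abscissa \<open>fst y\<close>; averaging this linear inequality yields it for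
    \<open>y\<close>.\<close>
  have "(\<Sum>i\<in>I - {j}. v i * (2 * fst y * fst (x i) - (fst y)\<^sup>2)) \<le> (\<Sum>i\<in>I - {j}. v i * snd (x i))"
  proof (intro sum_mono mult_left_mono v_nonneg)
    fix i assume "i \<in> I - {j}"
    then have "(fst (x i))\<^sup>2 \<le> snd (x i)"
      using mem[of i] by (auto simp: Omega_def split: prod.splits)
    then show "2 * fst y * fst (x i) - (fst y)\<^sup>2 \<le> snd (x i)"
      using zero_le_power2[of "fst (x i) - fst y"] by (simp add: power2_diff algebra_simps)
  qed
  also have "(\<Sum>i\<in>I - {j}. v i * (2 * fst y * fst (x i) - (fst y)\<^sup>2))
      = 2 * fst y * (\<Sum>i\<in>I - {j}. v i * fst (x i)) - sum v (I - {j}) * (fst y)\<^sup>2"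
    by (simp add: right_diff_distrib sum_subtractf sum_distrib_left sum_distrib_right mult_ac)
  also have "(\<Sum>i\<in>I - {j}. v i * fst (x i)) = fst y"
    by (simp add: y_def fst_sum)
  also have "(\<Sum>i\<in>I - {j}. v i * snd (x i)) = snd y"
    by (simp add: y_def snd_sum)
  finally have "(fst y)\<^sup>2 \<le> snd y"
    by (simp add: v_sum power2_eq_square)
  with upper have "y \<in> Omega \<epsilon>"
    by (auto simp: Omega_def split: prod.splits)
  with j that show thesis
    by (simp add: y_def v_def)
qed

text \<open>A finite Jensen inequality on a non-convex domain. Peeling off a well-chosen point keeps
  the barycenter of the others in the domain, so the two-point inequality applies at each
  stage.\<close>

lemma alpha_concave_on_Omega_sum:
  fixes w :: "'i \<Rightarrow> real" and x :: "'i \<Rightarrow> real \<times> real"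
  assumes conc: "alpha_concave_on \<alpha> (Omega \<epsilon>) B" and \<alpha>: "0 < \<alpha>"
    and "finite I" "sum w I = 1"
    and "\<And>i. i \<in> I \<Longrightarrow> \<alpha> \<le> w i"
    and "\<And>i. i \<in> I \<Longrightarrow> x i \<in> Omega \<epsilon>"
    and "(\<Sum>i\<in>I. w i *\<^sub>R x i) \<in> Omega \<epsilon>"
  shows "(\<Sum>i\<in>I. w i * B (x i)) \<le> B (\<Sum>i\<in>I. w i *\<^sub>R x i)"
  using assms(3-)
proof (induction "card I" arbitrary: I w)
  \<comment> \<open>An empty index set contradicts total weight 1.\<close>
  case 0
  then show ?case by simp
next
  case (Suc n)
  note fin = \<open>finite I\<close> and sum1 = \<open>sum w I = 1\<close>
  have pos: "0 < w i" if "i \<in> I" for i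
    using Suc.prems(3)[OF that] \<alpha> by simp
  show ?case
  proof (cases "\<exists>i. I = {i}")
    case True
    then show ?thesis using sum1 by auto
  next
    case False
    \<comment> \<open>A second index exists, and its weight alone is at least \<alpha>. Hence both
      \<open>w j\<close> and its complement are at least \<alpha>.\<close>
    have rest: "\<alpha> \<le> 1 - w j" if j: "j \<in> I" for j
    proof -
      obtain k where k: "k \<in> I - {j}"
        using False j by blast
      have "\<alpha> \<le> w k"
        using k Suc.prems(3) by blast
      also have "\<dots> \<le> sum w (I - {j})"
        using k fin pos by (intro member_le_sum) (auto simp: less_imp_le)
      finally show ?thesis
        using fin j sum1 by (simp add: sum_diff1)
    qed
    have less1: "w j < 1" if "j \<in> I" for j
      using rest[OF that] \<alpha> by simp
    obtain j where j: "j \<in> I" and y_mem: "(\<Sum>i\<in>I - {j}. (w i / (1 - w j)) *\<^sub>R x i) \<in> Omega \<epsilon>"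
      using split_off_point_in_Omega[OF fin sum1 pos less1 Suc.prems(4,5)] by blast
    define y where "y = (\<Sum>i\<in>I - {j}. (w i / (1 - w j)) *\<^sub>R x i)"
    have wj: "0 < w j" "w j < 1"
      using pos less1 j by auto
    have IH: "(\<Sum>i\<in>I - {j}. (w i / (1 - w j)) * B (x i)) \<le> B y"
      unfolding y_def
    proof (rule Suc.hyps(1))
      show "n = card (I - {j})"
        using Suc.hyps(2) fin j by simp
      show "(\<Sum>i\<in>I - {j}. w i / (1 - w j)) = 1"
        using wj fin j sum1 by (simp add: sum_diff1 flip: sum_divide_distrib)
      fix i assume i: "i \<in> I - {j}"
      then have "w i * (1 - w j) \<le> w i"
        using pos[of i] wj by (simp add: mult_le_cancel_left1)
      then have "w i \<le> w i / (1 - w j)"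
        using wj by (simp add: field_simps)
      then show "\<alpha> \<le> w i / (1 - w j)"
        using Suc.prems(3)[of i] i by simp
    qed (use fin Suc.prems y_mem in auto)
    have p_eq: "(\<Sum>i\<in>I. w i *\<^sub>R x i) = w j *\<^sub>R x j + (1 - w j) *\<^sub>R y"
      using fin j wj by (simp add: y_def sum.remove[of I j] scaleR_sum_right)
    have mem: "x j \<in> Omega \<epsilon>" "y \<in> Omega \<epsilon>" "w j *\<^sub>R x j + (1 - w j) *\<^sub>R y \<in> Omega \<epsilon>"
      using Suc.prems(4)[OF j] Suc.prems(5) y_mem by (simp_all add: p_eq y_def)
    \<comment> \<open>The definition admits only ratios up to 1/2, so the smaller of
      \<open>w j\<close> and \<open>1 - w j\<close> must serve as \<beta>; in the second case the
      two points trade places.\<close>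
    have "w j * B (x j) + (1 - w j) * B y \<le> B (w j *\<^sub>R x j + (1 - w j) *\<^sub>R y)"
    proof (cases "w j \<le> 1/2")
      case True
      then have "w j \<in> {\<alpha>..1/2}"
        using Suc.prems(3)[OF j] by simp
      with conc mem show ?thesis
        by (simp add: alpha_concave_on_def)
    next
      case False
      then have "1 - w j \<in> {\<alpha>..1/2}"
        using rest[OF j] by simp
      then have "(1 - w j) * B y + (1 - (1 - w j)) * B (x j)
          \<le> B ((1 - w j) *\<^sub>R y + (1 - (1 - w j)) *\<^sub>R x j)"
        using conc[unfolded alpha_concave_on_def, rule_format, of "1 - w j" y "x j"] mem
        by (simp add: add.commute)
      then show ?thesis
        by (simp add: add.commute)
    qed
    moreover have "(\<Sum>i\<in>I. w i * B (x i))
        = w j * B (x j) + (1 - w j) * (\<Sum>i\<in>I - {j}. (w i / (1 - w j)) * B (x i))"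
      using fin j wj by (simp add: sum.remove[of I j] sum_distrib_left)
    moreover have "(1 - w j) * (\<Sum>i\<in>I - {j}. (w i / (1 - w j)) * B (x i)) \<le> (1 - w j) * B y"
      using IH wj by (intro mult_left_mono) auto
    ultimately show ?thesis
      unfolding p_eq by linarith
  qed
qed

lemma alpha_convex_on_iff_concave:
  "alpha_convex_on \<alpha> S b \<longleftrightarrow> alpha_concave_on \<alpha> S (\<lambda>x. - b x)"
  by (simp add: alpha_convex_on_def alpha_concave_on_def algebra_simps)

section \<open>Trees and averages\<close>

text \<open>The preimages of a measurable set under \<open>f\<close> and \<open>g\<close> differ by
  a null set, which completeness makes measurable. This lets functions that are merely constant a.e.
  be integrated.\<close>

lemma (in complete_measure) measurable_cong_AE_complete:
  assumes g: "g \<in> measurable M N" and ae: "AE x in M. f x = g x"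
    and f: "f \<in> space M \<rightarrow> space N"
  shows "f \<in> measurable M N"
proof (rule measurableI)
  fix A assume A: "A \<in> sets N"
  show "f -` A \<inter> space M \<in> sets M"
  proof (rule in_sets_AE)
    show "AE x in M. x \<in> g -` A \<inter> space M \<longleftrightarrow> x \<in> f -` A \<inter> space M"
      using ae by eventually_elim auto
  qed (use g A in auto)
qed (use f in auto)

locale tree_space =
  fixes \<alpha> :: real and M :: "'a measure" and T :: "'a set set" and C :: "'a set \<Rightarrow> 'a set set"
  assumes tree: "alpha_tree \<alpha> M T C"

sublocale tree_space \<subseteq> finite_measure M
  using tree by (intro finite_measureI) (auto simp: alpha_tree_def)

context tree_space
begin

section \<open>Consequences of the tree axioms for measures and children\<close>

lemma space_pos: "0 < emeasure M (space M)"
  using tree unfolding alpha_tree_def by (elim conjE)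

lemma \<alpha>_pos: "0 < \<alpha>"
  using tree unfolding alpha_tree_def by (elim conjE)

lemma space_in_T: "space M \<in> T"
  using tree unfolding alpha_tree_def by (elim conjE)

lemma T_sets: "J \<in> T \<Longrightarrow> J \<in> sets M"
  using tree unfolding alpha_tree_def by (elim conjE) (rule subsetD)

lemma T_eq_generations: "T = (\<Union>m. generation M C m)"
  using tree unfolding alpha_tree_def by (elim conjE)

lemma generation_T: "J \<in> generation M C m \<Longrightarrow> J \<in> T"
  by (auto simp: T_eq_generations)

lemma children:
  assumes "J \<in> T"
  shows "C J \<subseteq> T \<and> J = \<Union>(C J) \<and> pairwise (\<lambda>I I'. I \<inter> I' \<in> null_sets M) (C J) \<and>
    (\<forall>I\<in>C J. measure M I \<ge> \<alpha> * measure M J)"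
  using tree assms unfolding alpha_tree_def by (elim conjE) (rule bspec)

lemma children_T: "J \<in> T \<Longrightarrow> I \<in> C J \<Longrightarrow> I \<in> T"
  using children by blast

lemma Union_children: "J \<in> T \<Longrightarrow> \<Union>(C J) = J"
  using children by blast

lemma measure_children: "J \<in> T \<Longrightarrow> I \<in> C J \<Longrightarrow> \<alpha> * measure M J \<le> measure M I"
  using children by blast

lemma children_AE_disjoint:
  assumes "J \<in> T" "I \<in> C J" "I' \<in> C J" "I \<noteq> I'"
  shows "AE x in M. x \<notin> I \<or> x \<notin> I'"
proof -
  have "I \<inter> I' \<in> null_sets M"
    using children[OF assms(1)] assms(2-) by (auto simp: pairwise_def)
  then show ?thesis
    by (auto dest: AE_not_in)
qed

text \<open>Each generation loses at most a factor \<alpha> > 0, starting from the positive measure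
  of the whole space. Thus no average divides by zero.\<close>

lemma measure_pos:
  assumes "J \<in> T"
  shows "0 < measure M J"
proof -
  have "0 < measure M J" if "J \<in> generation M C m" for m
    using that
  proof (induction m arbitrary: J)
    case 0
    then show ?case
      using space_pos by (simp add: emeasure_eq_measure)
  next
    case (Suc m)
    then obtain J' where J': "J' \<in> generation M C m" "J \<in> C J'"
      by auto
    then have "0 < \<alpha> * measure M J'"
      using Suc.IH \<alpha>_pos by simp
    then show ?case
      using measure_children[OF generation_T[OF J'(1)] J'(2)] by simp
  qed
  then show ?thesis
    using assms by (auto simp: T_eq_generations)
qed

lemma measure_Union_children_subset:
  assumes J: "J \<in> T" and F: "finite F" "F \<subseteq> C J"
  shows "measure M (\<Union>F) = (\<Sum>I\<in>F. measure M I)"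
proof (rule measure_Union_AE)
  show "pairwise (\<lambda>S S'. AE x in M. x \<notin> S \<or> x \<notin> S') F"
    using children_AE_disjoint[OF J] F by (auto simp: pairwise_def subset_iff)
  show "S \<in> fmeasurable M" if "S \<in> F" for S
    using that F children_T[OF J] T_sets by (auto simp: fmeasurable_eq_sets)
qed (fact F)

text \<open>Children overlap only in null sets and each takes at least the share \<alpha> of
  \<open>J\<close>, so more than 1/\<alpha> of them would exceed the measure of
  \<open>J\<close>.\<close>

lemma finite_children:
  assumes J: "J \<in> T"
  shows "finite (C J)"
proof (rule ccontr)
  assume inf: "infinite (C J)"
  obtain n :: nat where n: "1 < of_nat n * \<alpha>"
    using \<alpha>_pos reals_Archimedean3 by blast
  obtain F where F: "F \<subseteq> C J" "finite F" "card F = n"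
    using infinite_arbitrarily_large[OF inf] by blast
  have "of_nat n * (\<alpha> * measure M J) = (\<Sum>I\<in>F. \<alpha> * measure M J)"
    using F by simp
  also have "\<dots> \<le> (\<Sum>I\<in>F. measure M I)"
    using F measure_children[OF J] by (intro sum_mono) auto
  also have "\<dots> = measure M (\<Union>F)"
    using measure_Union_children_subset J F by simp
  also have "\<dots> \<le> measure M J"
    using F Union_children[OF J] T_sets[OF J] by (intro finite_measure_mono) auto
  finally have "(of_nat n * \<alpha>) * measure M J \<le> 1 * measure M J"
    by simp
  then show False
    using n measure_pos[OF J] by (simp only: mult_le_cancel_right) auto
qed

lemma sum_measure_children: "J \<in> T \<Longrightarrow> (\<Sum>I\<in>C J. measure M I) = measure M J"
  using measure_Union_children_subset[of J "C J"] by (simp add: finite_children Union_children)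

lemma finite_generation: "finite (generation M C m)"
  by (induction m) (auto intro: finite_children generation_T)

lemma Union_generation: "\<Union>(generation M C m) = space M"
proof (induction m)
  case (Suc m)
  have "\<Union>(generation M C (Suc m)) = (\<Union>J\<in>generation M C m. \<Union>(C J))"
    by auto
  also have "\<dots> = \<Union>(generation M C m)"
    using Union_children generation_T by auto
  finally show ?case
    using Suc by simp
qed simp

section \<open>Averages over tree elements\<close>

lemma set_integrable_completion:
  fixes f :: "'a \<Rightarrow> real"
  assumes "integrable (completion M) f" "J \<in> T"
  shows "set_integrable (completion M) J f"
  unfolding set_integrable_def using assms T_sets
  by (intro integrable_mult_indicator) auto

text \<open>No measurability of \<open>f\<close> is assumed: on \<open>J\<close> it agrees a.e. with
  a constant, which suffices in the completion.\<close>

lemma avg_const_AE: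
  assumes J: "J \<in> T" and f: "AE x in M. x \<in> J \<longrightarrow> f x = c"
  shows "avg M J f = c"
proof -
  have ae: "AE x in completion M. indicator J x *\<^sub>R f x = indicator J x *\<^sub>R c"
    using AE_completion[OF f] by eventually_elim (auto simp: indicator_def)
  have meas: "(\<lambda>x. indicator J x *\<^sub>R c) \<in> borel_measurable (completion M)"
    using T_sets[OF J] by (intro borel_measurable_scaleR borel_measurable_indicator) auto
  have "(\<lambda>x. indicator J x *\<^sub>R f x) \<in> borel_measurable (completion M)"
    by (rule completion.measurable_cong_AE_complete[OF meas ae]) auto
  then have "(LINT x:J|completion M. f x) = (LINT x:J|completion M. c)"
    unfolding set_lebesgue_integral_def using meas ae by (intro integral_cong_AE)
  also have "\<dots> = c * measure M J"
    using T_sets[OF J] by (simp add: set_lebesgue_integral_def sets.Int_space_eq2)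
  finally show ?thesis
    using measure_pos[OF J] by (simp add: avg_def)
qed

lemma avg_eq_sum_children:
  assumes f: "integrable (completion M) f" and J: "J \<in> T"
  shows "avg M J f = (\<Sum>I\<in>C J. (measure M I / measure M J) * avg M I f)"
proof -
  have "(LINT x:(\<Union>I\<in>C J. I)|completion M. f x) = (\<Sum>I\<in>C J. LINT x:I|completion M. f x)"
  proof (rule set_integral_finite_UN_AE)
    show "AE x in completion M. x \<in> I \<and> x \<in> I' \<longrightarrow> I = I'" if "I \<in> C J" "I' \<in> C J" for I I'
      using AE_completion[OF children_AE_disjoint[OF J that]] by (cases "I = I'") auto
  qed (use J f finite_children children_T T_sets set_integrable_completion in auto)
  also have "(\<Union>I\<in>C J. I) = J"
    using Union_children[OF J] by simp
  finally have "avg M J f = (\<Sum>I\<in>C J. (LINT x:I|completion M. f x) / measure M J)"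
    by (simp add: avg_def sum_divide_distrib)
  also have "\<dots> = (\<Sum>I\<in>C J. (measure M I / measure M J) * avg M I f)"
    using measure_pos children_T[OF J] by (intro sum.cong) (auto simp: avg_def less_le)
  finally show ?thesis .
qed

lemma avg_mono_AE:
  assumes "integrable (completion M) f" "integrable (completion M) g"
    and "AE x in M. f x \<le> g x" and J: "J \<in> T"
  shows "avg M J f \<le> avg M J g"
proof -
  have "(LINT x:J|completion M. f x) \<le> (LINT x:J|completion M. g x)"
    using assms AE_completion[OF assms(3)]
    by (intro set_integral_mono_AE set_integrable_completion) auto
  then show ?thesis
    using measure_pos[OF J] by (simp add: avg_def divide_right_mono)
qed

lemma avg_power2_le:
  assumes f: "integrable (completion M) f" "integrable (completion M) (\<lambda>x. (f x)\<^sup>2)" and J: "J \<in> T"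
  shows "(avg M J f)\<^sup>2 \<le> avg M J (\<lambda>x. (f x)\<^sup>2)"
proof -
  define a where "a = avg M J f"
  \<comment> \<open>The expansion of \<open>(f x - a)\<^sup>2 \<ge> 0\<close>. Since
    \<open>a\<close> is the mean of \<open>f\<close>, the left side averages to
    \<open>a\<^sup>2\<close>.\<close>
  have "AE x in M. 2 * a * f x - a\<^sup>2 \<le> (f x)\<^sup>2"
  proof (rule AE_I2)
    fix x show "2 * a * f x - a\<^sup>2 \<le> (f x)\<^sup>2"
      using zero_le_power2[of "f x - a"] by (simp add: power2_diff algebra_simps)
  qed
  moreover have const: "integrable (completion M) (\<lambda>x. a\<^sup>2)"
    by (simp add: integrable_completion)
  ultimately have "avg M J (\<lambda>x. 2 * a * f x - a\<^sup>2) \<le> avg M J (\<lambda>x. (f x)\<^sup>2)"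
    using f J by (intro avg_mono_AE) auto
  also have "avg M J (\<lambda>x. 2 * a * f x - a\<^sup>2) = 2 * a * avg M J f - avg M J (\<lambda>x. a\<^sup>2)"
    using f J const by (simp add: avg_def set_integral_diff(2) set_integrable_completion right_diff_distrib)
  also have "avg M J (\<lambda>x. a\<^sup>2) = a\<^sup>2"
    using J by (intro avg_const_AE) auto
  finally show ?thesis
    by (simp add: a_def power2_eq_square)
qed

end

section \<open>Simple functions on trees\<close>

locale simple_function_on_tree = tree_space +
  fixes \<phi> :: "'a \<Rightarrow> real"
  assumes simple: "tree_simple M C \<phi>"
begin

lemma simple_level:
  obtains N c where "\<And>J. J \<in> generation M C N \<Longrightarrow> AE x in M. x \<in> J \<longrightarrow> \<phi> x = c J"
proof -
  obtain N where "\<forall>J\<in>generation M C N. \<exists>c. AE x in M. x \<in> J \<longrightarrow> \<phi> x = c"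
    using simple unfolding tree_simple_def by (elim exE)
  then have "\<exists>c. \<forall>J\<in>generation M C N. AE x in M. x \<in> J \<longrightarrow> \<phi> x = c J"
    by (rule bchoice)
  then obtain c where "\<forall>J\<in>generation M C N. AE x in M. x \<in> J \<longrightarrow> \<phi> x = c J"
    by (elim exE)
  then show thesis
    by (intro that) (rule bspec)
qed

lemma simple_AE_bounded:
  obtains K where "AE x in M. \<bar>\<phi> x\<bar> \<le> K"
proof -
  obtain N c where c: "\<And>J. J \<in> generation M C N \<Longrightarrow> AE x in M. x \<in> J \<longrightarrow> \<phi> x = c J"
    using simple_level by blast
  have "AE x in M. \<forall>J\<in>generation M C N. x \<in> J \<longrightarrow> \<phi> x = c J"
    using c finite_generation by (intro AE_finite_allI) auto
  \<comment> \<open>The sum is a convenient common bound for the finitely many values.\<close>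
  then have "AE x in M. \<bar>\<phi> x\<bar> \<le> (\<Sum>J\<in>generation M C N. \<bar>c J\<bar>)"
    using AE_space
  proof eventually_elim
    case (elim x)
    then obtain J where J: "J \<in> generation M C N" "x \<in> J"
      using Union_generation by blast
    have "\<bar>c J\<bar> \<le> (\<Sum>J\<in>generation M C N. \<bar>c J\<bar>)"
      using J finite_generation by (intro member_le_sum) auto
    then show ?case
      using elim J by auto
  qed
  then show thesis
    by (rule that)
qed

text \<open>The function \<open>h\<close> may be arbitrary, because the composition is a.e. constant
  on each of finitely many sets covering the space. This covers \<phi>, its square and
  \<open>B (\<phi> x, (\<phi> x)\<^sup>2)\<close> at once.\<close>

lemma integrable_compose_simple:
  fixes h :: "real \<Rightarrow> real"
  shows "integrable (completion M) (\<lambda>x. h (\<phi> x))"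
proof -
  obtain N c where c: "\<And>J. J \<in> generation M C N \<Longrightarrow> AE x in M. x \<in> J \<longrightarrow> \<phi> x = c J"
    using simple_level by blast
  have "set_integrable (completion M) J (\<lambda>x. h (\<phi> x))" if J: "J \<in> generation M C N" for J
  proof -
    have sets: "J \<in> sets M"
      using J generation_T T_sets by blast
    have ae: "AE x in completion M. indicator J x *\<^sub>R h (\<phi> x) = indicator J x *\<^sub>R h (c J)"
      using AE_completion[OF c[OF J]] by eventually_elim (auto simp: indicator_def)
    have int: "integrable (completion M) (\<lambda>x. indicator J x *\<^sub>R h (c J))"
      using sets by (intro integrable_scaleR_left integrable_real_indicator)
        (auto simp: less_top[symmetric])
    then have "(\<lambda>x. indicator J x *\<^sub>R h (\<phi> x)) \<in> borel_measurable (completion M)"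
      using ae by (intro completion.measurable_cong_AE_complete[OF _ ae]) auto
    with int show ?thesis
      unfolding set_integrable_def
    proof (rule integrable_cong_AE_imp)
      show "AE x in completion M. indicator J x *\<^sub>R h (c J) = indicator J x *\<^sub>R h (\<phi> x)"
        using ae by eventually_elim (rule sym)
    qed
  qed
  then have "set_integrable (completion M) (\<Union>J\<in>generation M C N. J) (\<lambda>x. h (\<phi> x))"
    using finite_generation generation_T T_sets by (intro set_integrable_UN) auto
  then have "set_integrable (completion M) (space M) (\<lambda>x. h (\<phi> x))"
    by (simp add: Union_generation)
  moreover have "integrable (completion M) (\<lambda>x. indicator (space M) x *\<^sub>R h (\<phi> x))
      \<longleftrightarrow> integrable (completion M) (\<lambda>x. h (\<phi> x))"
    by (rule Bochner_Integration.integrable_cong) auto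
  ultimately show ?thesis
    by (simp only: set_integrable_def)
qed

lemma variance_nonneg:
  assumes "J \<in> T"
  shows "0 \<le> avg M J (\<lambda>x. (\<phi> x)\<^sup>2) - (avg M J \<phi>)\<^sup>2"
  using avg_power2_le[of \<phi> J] integrable_compose_simple[of "\<lambda>t. t"]
    integrable_compose_simple[of "\<lambda>t. t\<^sup>2"] assms by simp

text \<open>Finiteness ensures that \<open>real_of_ereal\<close> returns the actual norm, rather
  than its default value 0 at infinity.\<close>

lemma bmo_norm_eq_ereal:
  obtains r where "bmo_norm M T \<phi> = ereal r"
proof -
  obtain K where K: "AE x in M. \<bar>\<phi> x\<bar> \<le> K"
    using simple_AE_bounded by blast
  \<comment> \<open>Writing the bound as a square root reduces the claim to a variance of at most
    \<open>K\<^sup>2\<close>.\<close>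
  have "bmo_norm M T \<phi> \<le> ereal (sqrt (K\<^sup>2))"
    unfolding bmo_norm_def
  proof (intro SUP_least, unfold ereal_less_eq, intro real_sqrt_le_mono)
    fix J assume J: "J \<in> T"
    have ae: "AE x in M. (\<phi> x)\<^sup>2 \<le> K\<^sup>2"
      using K by eventually_elim (simp add: abs_le_square_iff[symmetric])
    have "avg M J (\<lambda>x. (\<phi> x)\<^sup>2) \<le> avg M J (\<lambda>x. K\<^sup>2)"
      using J ae integrable_compose_simple[of "\<lambda>t. t\<^sup>2"] integrable_compose_simple[of "\<lambda>t. K\<^sup>2"]
      by (intro avg_mono_AE)
    also have "\<dots> = K\<^sup>2"
      using J by (intro avg_const_AE) auto
    finally show "avg M J (\<lambda>x. (\<phi> x)\<^sup>2) - (avg M J \<phi>)\<^sup>2 \<le> K\<^sup>2"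
      using zero_le_power2[of "avg M J \<phi>"] by linarith
  qed
  moreover have "0 \<le> bmo_norm M T \<phi>"
    unfolding bmo_norm_def using space_in_T variance_nonneg[OF space_in_T]
    by (intro SUP_upper2[of "space M"]) auto
  ultimately show thesis
    using that by (cases "bmo_norm M T \<phi>") auto
qed

text \<open>The lower constraint is nonnegativity of the variance on \<open>J\<close>; the upper one
  holds because the norm is a supremum over \<open>T\<close>.\<close>

lemma averages_in_Omega:
  assumes J: "J \<in> T"
  shows "(avg M J \<phi>, avg M J (\<lambda>x. (\<phi> x)\<^sup>2)) \<in> Omega (real_of_ereal (bmo_norm M T \<phi>))"
proof -
  obtain r where r: "bmo_norm M T \<phi> = ereal r"
    using bmo_norm_eq_ereal by blast
  have "ereal (sqrt (avg M J (\<lambda>x. (\<phi> x)\<^sup>2) - (avg M J \<phi>)\<^sup>2)) \<le> ereal r"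
    unfolding r[symmetric] bmo_norm_def using J by (rule SUP_upper)
  then have "avg M J (\<lambda>x. (\<phi> x)\<^sup>2) - (avg M J \<phi>)\<^sup>2 \<le> r\<^sup>2"
    by (simp add: sqrt_le_D)
  then show ?thesis
    using variance_nonneg[OF J] by (simp add: Omega_def r)
qed

lemma alpha_concave_avg_le:
  assumes conc: "alpha_concave_on \<alpha> (Omega (real_of_ereal (bmo_norm M T \<phi>))) B"
  shows "avg M (space M) (\<lambda>x. B (\<phi> x, (\<phi> x)\<^sup>2))
      \<le> B (avg M (space M) \<phi>, avg M (space M) (\<lambda>x. (\<phi> x)\<^sup>2))"
proof -
  define X where "X J = (avg M J \<phi>, avg M J (\<lambda>x. (\<phi> x)\<^sup>2))" for J
  obtain N c where c: "\<And>J. J \<in> generation M C N \<Longrightarrow> AE x in M. x \<in> J \<longrightarrow> \<phi> x = c J"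
    using simple_level by blast
  have "\<forall>J\<in>generation M C 0. avg M J (\<lambda>x. B (\<phi> x, (\<phi> x)\<^sup>2)) \<le> B (X J)"
  \<comment> \<open>Induction runs downward from generation \<open>N\<close> to the root.\<close>
  proof (rule inc_induct[of 0 N])
    show "\<forall>J\<in>generation M C N. avg M J (\<lambda>x. B (\<phi> x, (\<phi> x)\<^sup>2)) \<le> B (X J)"
    proof
      fix J assume J: "J \<in> generation M C N"
      have "avg M J (\<lambda>x. h (\<phi> x)) = h (c J)" for h
      proof (rule avg_const_AE)
        show "AE x in M. x \<in> J \<longrightarrow> h (\<phi> x) = h (c J)"
          using c[OF J] by eventually_elim auto
      qed (use J generation_T in blast)
      \<comment> \<open>On generation \<open>N\<close> both sides equal
        \<open>B (c J, (c J)\<^sup>2)\<close>.\<close>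
      from this[of "\<lambda>t. t"] this[of "\<lambda>t. t\<^sup>2"] this[of "\<lambda>t. B (t, t\<^sup>2)"]
      show "avg M J (\<lambda>x. B (\<phi> x, (\<phi> x)\<^sup>2)) \<le> B (X J)"
        by (simp add: X_def)
    qed
  next
    fix m assume IH: "\<forall>J\<in>generation M C (Suc m). avg M J (\<lambda>x. B (\<phi> x, (\<phi> x)\<^sup>2)) \<le> B (X J)"
    show "\<forall>J\<in>generation M C m. avg M J (\<lambda>x. B (\<phi> x, (\<phi> x)\<^sup>2)) \<le> B (X J)"
    proof
      fix J assume gen: "J \<in> generation M C m"
      then have J: "J \<in> T"
        by (rule generation_T)
      define w where "w I = measure M I / measure M J" for I
      have split: "avg M J (\<lambda>x. h (\<phi> x)) = (\<Sum>I\<in>C J. w I * avg M I (\<lambda>x. h (\<phi> x)))" for h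
        unfolding w_def using integrable_compose_simple J by (rule avg_eq_sum_children)
      \<comment> \<open>Both coordinates average with the same weights, so \<open>X J\<close> is the
        barycenter of the points of the children.\<close>
      have X_J: "X J = (\<Sum>I\<in>C J. w I *\<^sub>R X I)"
        using split[of "\<lambda>t. t"] split[of "\<lambda>t. t\<^sup>2"]
        by (simp add: X_def prod_eq_iff fst_sum snd_sum)
      have "avg M J (\<lambda>x. B (\<phi> x, (\<phi> x)\<^sup>2)) = (\<Sum>I\<in>C J. w I * avg M I (\<lambda>x. B (\<phi> x, (\<phi> x)\<^sup>2)))"
        by (rule split)
      also have "\<dots> \<le> (\<Sum>I\<in>C J. w I * B (X I))"
        using IH gen by (intro sum_mono mult_left_mono) (auto simp: w_def)
      also have "\<dots> \<le> B (\<Sum>I\<in>C J. w I *\<^sub>R X I)"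
      proof (rule alpha_concave_on_Omega_sum[OF conc \<alpha>_pos finite_children[OF J]])
        show "sum w (C J) = 1"
          using sum_measure_children[OF J] measure_pos[OF J]
          by (simp add: w_def flip: sum_divide_distrib)
        show "\<alpha> \<le> w I" if "I \<in> C J" for I
          using measure_children[OF J that] measure_pos[OF J] by (simp add: w_def field_simps)
        show "(\<Sum>I\<in>C J. w I *\<^sub>R X I) \<in> Omega (real_of_ereal (bmo_norm M T \<phi>))"
          using averages_in_Omega[OF J] unfolding X_J[symmetric] by (simp add: X_def)
      qed (use averages_in_Omega children_T[OF J] in \<open>auto simp: X_def\<close>)
      finally show "avg M J (\<lambda>x. B (\<phi> x, (\<phi> x)\<^sup>2)) \<le> B (X J)"
        by (simp add: X_J)
    qed
  qed simp
  then show ?thesis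
    by (simp add: X_def)
qed

end

section \<open>Boundedness, BMO membership and both inequalities\<close>

theorem lemma2p4:
  fixes M :: "'a measure" and T :: "'a set set" and C :: "'a set \<Rightarrow> 'a set set"
    and \<alpha> \<epsilon> :: real and \<phi> :: "'a \<Rightarrow> real"
  assumes "0 < \<alpha>" and "\<alpha> \<le> 1/2"
    and "alpha_tree \<alpha> M T C"
    and "tree_simple M C \<phi>"
    and "\<epsilon> = real_of_ereal (bmo_norm M T \<phi>)"
  shows "(\<exists>K. AE x in M. \<bar>\<phi> x\<bar> \<le> K) \<and> \<phi> \<in> BMO M T \<and>
    (\<forall>B. alpha_concave_on \<alpha> (Omega \<epsilon>) B \<longrightarrow>
       B (avg M (space M) \<phi>, avg M (space M) (\<lambda>x. (\<phi> x)\<^sup>2))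
         \<ge> 1 / measure M (space M) * (LINT x|completion M. B (\<phi> x, (\<phi> x)\<^sup>2))) \<and>
    (\<forall>b. alpha_convex_on \<alpha> (Omega \<epsilon>) b \<longrightarrow>
       b (avg M (space M) \<phi>, avg M (space M) (\<lambda>x. (\<phi> x)\<^sup>2))
         \<le> 1 / measure M (space M) * (LINT x|completion M. b (\<phi> x, (\<phi> x)\<^sup>2)))"
proof -
  interpret simple_function_on_tree \<alpha> M T C \<phi>
    using assms by unfold_locales
  have avg_space: "avg M (space M) f = 1 / measure M (space M) * (LINT x|completion M. f x)"
    if "integrable (completion M) f" for f
    using set_integral_space[OF that] by (simp add: avg_def)
  have bounded: "\<exists>K. AE x in M. \<bar>\<phi> x\<bar> \<le> K"
    using simple_AE_bounded by blast
  obtain r where "bmo_norm M T \<phi> = ereal r"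
    using bmo_norm_eq_ereal by blast
  then have bmo: "\<phi> \<in> BMO M T"
    using integrable_compose_simple[of "\<lambda>t. t"] integrable_compose_simple[of "\<lambda>t. t\<^sup>2"]
    by (simp add: BMO_def)
  have concave: "1 / measure M (space M) * (LINT x|completion M. B (\<phi> x, (\<phi> x)\<^sup>2))
      \<le> B (avg M (space M) \<phi>, avg M (space M) (\<lambda>x. (\<phi> x)\<^sup>2))"
    if "alpha_concave_on \<alpha> (Omega \<epsilon>) B" for B
    using alpha_concave_avg_le[of B] avg_space[OF integrable_compose_simple[of "\<lambda>t. B (t, t\<^sup>2)"]]
      that assms(5) by simp
  have convex: "b (avg M (space M) \<phi>, avg M (space M) (\<lambda>x. (\<phi> x)\<^sup>2))
      \<le> 1 / measure M (space M) * (LINT x|completion M. b (\<phi> x, (\<phi> x)\<^sup>2))"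
    if "alpha_convex_on \<alpha> (Omega \<epsilon>) b" for b
    \<comment> \<open>Negation turns the convex case into the concave one, and the sign passes
      through the integral.\<close>
    using concave[of "\<lambda>x. - b x"] that by (simp add: alpha_convex_on_iff_concave)
  show ?thesis
    using bounded bmo concave convex by (intro conjI allI impI)
qed

end
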